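(* There is an absolute constant $c>0$ such that for all integers $n\ge 5$, we have $r_4(5,n)\ge 2^{2^{c n^{1/7}}}$.
   Context: A $k$-uniform hypergraph ($k$-graph) $H$ consists of a vertex set $V(H)$ and a collection of $k$-element subsets of $V(H)$ (its edges). $K_s^{(k)}$ denotes the complete $k$-graph on $s$ vertices. An independent set in $H$ is a set of vertices containing no edge of $H$. The off-diagonal Ramsey number $r_k(s,n)$ is the smallest integer $N$ such that every $k$-graph on $N$ vertices contains either a copy of $K_s^{(k)}$ or an independent set of size $n$. *)

theory Defs
  imports Complex_Main "HOL-Library.Ramsey"
begin

definition kgraph :: "nat \<Rightarrow> 'a set \<Rightarrow> 'a set set \<Rightarrow> bool" where
  "kgraph k V E \<longleftrightarrow> finite V \<and> E \<subseteq> [V]\<^bsup>k\<^esup>"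

definition contains_complete :: "nat \<Rightarrow> nat \<Rightarrow> 'a set \<Rightarrow> 'a set set \<Rightarrow> bool" where
  "contains_complete k s V E \<longleftrightarrow> (\<exists>S \<subseteq> V. card S = s \<and> [S]\<^bsup>k\<^esup> \<subseteq> E)"

definition independent_set :: "'a set \<Rightarrow> 'a set set \<Rightarrow> 'a set \<Rightarrow> bool" where
  "independent_set V E S \<longleftrightarrow> S \<subseteq> V \<and> (\<forall>e\<in>E. \<not> e \<subseteq> S)"

text \<open>Every finite \<open>k\<close>-graph is isomorphic to one whose vertices are natural numbers,
  so it suffices to let \<open>V\<close> range over sets of naturals.\<close>

definition ramsey_property :: "nat \<Rightarrow> nat \<Rightarrow> nat \<Rightarrow> nat \<Rightarrow> bool" where
  "ramsey_property k s n N \<longleftrightarrow>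
     (\<forall>(V :: nat set) E. kgraph k V E \<and> card V = N \<longrightarrow>
        contains_complete k s V E \<or> (\<exists>S. independent_set V E S \<and> card S = n))"

definition ramsey_number :: "nat \<Rightarrow> nat \<Rightarrow> nat \<Rightarrow> nat" where
  "ramsey_number k s n = (LEAST N. ramsey_property k s n N)"

text \<open>By Ramsey's theorem the minimum is attained, so \<^const>\<open>ramsey_number\<close> is never an
  unspecified value.\<close>

lemma ex_ramsey_property: "\<exists>N. ramsey_property k s n N"
proof -
  obtain N :: nat where N: "partn_lst {..<N} [s, n] k"
    using ramsey_full by blast
  have "ramsey_property k s n N"
    unfolding ramsey_property_def
  proof (intro allI impI)
    fix V :: "nat set" and E
    assume "kgraph k V E \<and> card V = N"
    then have fin: "finite V" and E: "E \<subseteq> [V]\<^bsup>k\<^esup>" and card: "card V = N"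
      by (auto simp: kgraph_def)
    obtain g where g: "bij_betw g {..<N} V"
      using ex_bij_betw_nat_finite[OF fin] card by (auto simp: atLeast0LessThan)
    define f :: "nat set \<Rightarrow> nat" where "f = (\<lambda>e. if g ` e \<in> E then 0 else 1)"
    have "f \<in> [{..<N}]\<^bsup>k\<^esup> \<rightarrow> {..<2}"
      by (auto simp: f_def)
    then obtain i H where i: "i < length [s, n]" and H: "H \<in> nsets {..<N} ([s, n] ! i)"
      and mono: "f ` ([H]\<^bsup>k\<^esup>) \<subseteq> {i}"
      by (rule partn_lstE[OF N]) auto
    have HN: "H \<subseteq> {..<N}" and cardH: "card H = [s, n] ! i"
      using H by (auto simp: nsets_def)
    have bij: "bij_betw g H (g ` H)" and sub: "g ` H \<subseteq> V"
      using g HN by (auto simp: bij_betw_def intro: inj_on_subset)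
    have cardS: "card (g ` H) = [s, n] ! i"
      using bij cardH bij_betw_same_card by fastforce
    have img: "\<exists>d \<in> [H]\<^bsup>k\<^esup>. e = g ` d" if "e \<in> [g ` H]\<^bsup>k\<^esup>" for e
      using bij_betw_nsets[OF bij, of k] that unfolding bij_betw_def by blast
    consider "i = 0" | "i = 1" using i by fastforce
    then show "contains_complete k s V E \<or> (\<exists>S. independent_set V E S \<and> card S = n)"
    proof cases
      case 1
      have "[g ` H]\<^bsup>k\<^esup> \<subseteq> E"
      proof
        fix e assume "e \<in> [g ` H]\<^bsup>k\<^esup>"
        then obtain d where "d \<in> [H]\<^bsup>k\<^esup>" "e = g ` d" using img by blast
        with mono 1 show "e \<in> E" by (force simp: f_def split: if_splits)
      qed
      with 1 sub cardS show ?thesis by (auto simp: contains_complete_def)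
    next
      case 2
      have "\<not> e \<subseteq> g ` H" if "e \<in> E" for e
      proof
        assume "e \<subseteq> g ` H"
        with that E have "e \<in> [g ` H]\<^bsup>k\<^esup>" by (auto simp: nsets_def)
        then obtain d where "d \<in> [H]\<^bsup>k\<^esup>" "e = g ` d" using img by blast
        with mono 2 that show False by (force simp: f_def split: if_splits)
      qed
      with 2 sub cardS show ?thesis by (auto simp: independent_set_def)
    qed
  qed
  then show ?thesis ..
qed

end

theory Submission
  imports Defs
begin

text \<open>
  Vertices are the numbers below \<open>2 ^ N\<close> with \<open>N = 2 ^ m\<close>, regarded as leaves of the binary trie of their
  bits; two vertices branch at their top differing bit, a label below \<open>N\<close>. Fix a tournament on
  the labels, i.e. a 2-colouring of pairs, without transitive subtournaments of size \<open>M = 2 * m + 2\<close>. A 4-set is an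
  edge iff its trie is a caterpillar and the colours of its three labels match a pattern depending on its two
  turns (left or right); 4-sets splitting 2+2 are never edges. A 5-set is either a caterpillar, where the
  patterns of its five 4-subsets are inconsistent, or contains a 2+2 split.

  Let \<open>S\<close> be independent. If all turns of a subset of \<open>S\<close> agree, its labels span a transitive subtournament, so the
  subset has at most \<open>M\<close> elements. Let \<open>r\<close> be the top label of \<open>S\<close> and \<open>T\<close> a set of vertices on one side of it
  all of whose labels have the same colour towards \<open>r\<close>. The patterns then exclude paths with three
  alternating turns in \<open>T\<close>, whence \<open>T\<close> has at most \<open>M ^ 3\<close> elements. Each side of \<open>r\<close> has at most
  as many elements as the product of two such sets, one for each colour, so \<open>S\<close> has at most \<open>2 * M ^ 6\<close> elements.
\<close>

section \<open>The stepped-up hypergraph\<close>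

text \<open>Inserting 0 makes \<open>top_diff u u = 0\<close>, so that \<open>i < top_diff u v\<close> implies \<open>u \<noteq> v\<close>.\<close>

definition top_diff :: "nat \<Rightarrow> nat \<Rightarrow> nat" where
  "top_diff u v = Max (insert 0 {i. bit u i \<noteq> bit v i})"

lemma bit_imp_power_le: "bit u i \<Longrightarrow> 2 ^ i \<le> u" for u i :: nat
  by (rule ccontr) (simp add: bit_iff_odd)

lemma finite_bit_diff: "finite {i. bit u i \<noteq> bit v i}" for u v :: nat
  by (rule finite_subset[of _ "{..u + v}"]) (auto dest!: bit_imp_power_le intro: order.trans[OF less_imp_le[OF less_exp]] trans_le_add1 trans_le_add2)

lemma top_diff_commute: "top_diff u v = top_diff v u"
  unfolding top_diff_def by (metis (no_types, lifting))

lemma top_diff_self [simp]: "top_diff u u = 0"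
  by (simp add: top_diff_def)

lemma bit_above_top_diff: "top_diff u v < i \<Longrightarrow> bit u i = bit v i"
  using finite_bit_diff[of u v] by (auto simp: top_diff_def)

lemma bit_top_diff: "u \<noteq> v \<Longrightarrow> bit u (top_diff u v) \<noteq> bit v (top_diff u v)"
proof -
  assume "u \<noteq> v"
  then obtain i where "bit u i \<noteq> bit v i" by (auto simp: bit_eq_iff)
  then have ne: "{i. bit u i \<noteq> bit v i} \<noteq> {}" by auto
  then have "top_diff u v = Max {i. bit u i \<noteq> bit v i}"
    using finite_bit_diff[of u v] by (simp add: top_diff_def)
  then show ?thesis using Max_in[OF finite_bit_diff ne] by auto
qed

lemma top_diff_eqI:
  assumes "bit u i \<noteq> bit v i" "\<And>j. i < j \<Longrightarrow> bit u j = bit v j"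
  shows "top_diff u v = i"
  by (metis assms bit_above_top_diff bit_top_diff linorder_neqE_nat)

lemma top_diff_bound: "u < 2 ^ N \<Longrightarrow> v < 2 ^ N \<Longrightarrow> u \<noteq> v \<Longrightarrow> top_diff u v < N"
  using bit_top_diff[of u v] bit_imp_power_le[of u "top_diff u v"] bit_imp_power_le[of v "top_diff u v"]
  by (metis (no_types) le_less_trans one_less_numeral_iff power_less_imp_less_exp semiring_norm(76))

text \<open>Above \<open>top_diff y z\<close> the bits of \<open>y\<close> and \<open>z\<close>
  agree, so \<open>x\<close> cannot tell them apart there; this is the ultrametric step behind the
  trie arguments below.\<close>

lemma fork:
  assumes "y \<noteq> z" "top_diff y z < top_diff x y"
  shows "top_diff x z = top_diff x y" "bit z (top_diff x y) = bit y (top_diff x y)"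
    "bit x (top_diff x y) \<noteq> bit y (top_diff x y)" "x \<noteq> y" "x \<noteq> z"
proof -
  show xy: "x \<noteq> y" "x \<noteq> z" using assms by (auto simp: top_diff_commute[of z y])
  show "bit z (top_diff x y) = bit y (top_diff x y)"
    using bit_above_top_diff[OF assms(2)] by simp
  moreover show "bit x (top_diff x y) \<noteq> bit y (top_diff x y)"
    using bit_top_diff xy by blast
  ultimately show "top_diff x z = top_diff x y"
    by (intro top_diff_eqI) (auto simp: bit_above_top_diff dest: order.strict_trans[OF assms(2)])
qed

text \<open>A bit has only two values: \<open>y\<close> and \<open>z\<close> both differ from
  \<open>x\<close> at the common label, so they agree there as well as above it.\<close>

lemma top_diff_same_label:
  assumes "top_diff x y = top_diff x z" "x \<noteq> y" "x \<noteq> z" "y \<noteq> z"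
  shows "top_diff y z < top_diff x y"
  by (metis assms bit_above_top_diff bit_top_diff linorder_neqE_nat)

text \<open>The turns \<open>t1\<close>, \<open>t2\<close> are taken at the labels \<open>a > b\<close> of a caterpillar with labels \<open>a > b > c\<close>, and
  \<open>p\<close>, \<open>q\<close>, \<open>s\<close> are the colours of the pairs \<open>ab\<close>, \<open>ac\<close>, \<open>bc\<close>. Equal turns ask for a cyclic triangle of the
  tournament.\<close>

definition edge_pattern :: "bool \<Rightarrow> bool \<Rightarrow> bool \<Rightarrow> bool \<Rightarrow> bool \<Rightarrow> bool" where
  "edge_pattern t1 t2 p q s \<longleftrightarrow>
     (if t1 = t2 then p = s \<and> p \<noteq> q else p = q \<and> (s = p) = t2)"

text \<open>The vertices are listed in the order in which they leave the path from the top;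
  \<open>y\<close> and \<open>z\<close> are the last pair. Distinctness of this pair has to be
  demanded because \<open>top_diff y y = 0\<close> can satisfy the inequalities.\<close>

definition caterpillar :: "nat \<Rightarrow> nat \<Rightarrow> nat \<Rightarrow> nat \<Rightarrow> bool" where
  "caterpillar w x y z \<longleftrightarrow> y \<noteq> z \<and> top_diff y z < top_diff x y \<and> top_diff x y < top_diff w x"

text \<open>The turn at a label is the bit of the vertices that continue below it, not of the one
  that leaves.\<close>

definition caterpillar_edge :: "(nat \<Rightarrow> nat \<Rightarrow> bool) \<Rightarrow> nat \<Rightarrow> nat \<Rightarrow> nat \<Rightarrow> nat \<Rightarrow> bool" where
  "caterpillar_edge \<phi> w x y z \<longleftrightarrow> caterpillar w x y z \<and>
     edge_pattern (bit x (top_diff w x)) (bit y (top_diff x y))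
       (\<phi> (top_diff w x) (top_diff x y)) (\<phi> (top_diff w x) (top_diff y z))
       (\<phi> (top_diff x y) (top_diff y z))"

definition step_up :: "(nat \<Rightarrow> nat \<Rightarrow> bool) \<Rightarrow> nat set set" where
  "step_up \<phi> = {{w, x, y, z} | w x y z. caterpillar_edge \<phi> w x y z}"

lemma caterpillarD:
  assumes "caterpillar w x y z"
  shows "top_diff w y = top_diff w x" "top_diff w z = top_diff w x"
    "top_diff x z = top_diff x y" "distinct [w, x, y, z]"
    "bit y (top_diff w x) = bit x (top_diff w x)" "bit z (top_diff w x) = bit x (top_diff w x)"
    "bit z (top_diff x y) = bit y (top_diff x y)"
proof -
  have *: "y \<noteq> z" "top_diff y z < top_diff x y" "top_diff x y < top_diff w x"
    using assms by (auto simp: caterpillar_def)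
  note f1 = fork[OF *(1,2)]
  note f2 = fork[OF f1(4) *(3)]
  have f3: "top_diff w z = top_diff w x" "bit z (top_diff w x) = bit x (top_diff w x)" "w \<noteq> z"
    using fork[OF f1(5), of w] *(3) f1(1) by auto
  show "top_diff w y = top_diff w x" "top_diff w z = top_diff w x"
    "top_diff x z = top_diff x y" "distinct [w, x, y, z]"
    "bit y (top_diff w x) = bit x (top_diff w x)" "bit z (top_diff w x) = bit x (top_diff w x)"
    "bit z (top_diff x y) = bit y (top_diff x y)"
    using f1 f2 f3 * by auto
qed

text \<open>The vertex \<open>w\<close> meets all others at one label. Two such vertices and a third
  one would meet pairwise at the same label, which a binary trie excludes. After removing
  \<open>w\<close> the same argument fixes \<open>x\<close>; the last pair is determined up to a
  swap.\<close>

lemma caterpillar_unique: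
  assumes c: "caterpillar w x y z" and c': "caterpillar w' x' y' z'"
    and eq: "{w, x, y, z} = {w', x', y', z'}"
  shows "w = w' \<and> x = x' \<and> (y = y' \<and> z = z' \<or> y = z' \<and> z = y')"
proof -
  note d = caterpillarD(1-3)[OF c] caterpillarD(1-3)[OF c']
  have dist: "distinct [w, x, y, z]" "distinct [w', x', y', z']"
    using caterpillarD(4) c c' by blast+
  have w: "w = w'"
  proof (rule ccontr)
    assume ne: "w \<noteq> w'"
    have "w' \<in> {w, x, y, z}" unfolding eq by simp
    then have 1: "top_diff w w' = top_diff w x" using d ne by auto
    have "w \<in> {w', x', y', z'}" unfolding eq[symmetric] by simp
    then have 2: "top_diff w' w = top_diff w' x'" using d ne by auto
    obtain v where v: "v \<in> {w, x, y, z}" "v \<noteq> w" "v \<noteq> w'"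
      using dist by (cases "w' = x") auto
    then have 3: "top_diff w v = top_diff w x" using d by auto
    have "v \<in> {w', x', y', z'}" using v(1) unfolding eq .
    then have "top_diff w' v = top_diff w' x'" using d v by auto
    with 1 2 3 v ne show False
      using top_diff_same_label[of v w w'] by (metis top_diff_commute less_irrefl)
  qed
  have "{x, y, z} = {w, x, y, z} - {w}" using dist by auto
  also have "\<dots> = {w', x', y', z'} - {w'}" by (metis eq w)
  also have "\<dots> = {x', y', z'}" using dist by auto
  finally have eq2: "{x, y, z} = {x', y', z'}" .
  have x: "x = x'"
  proof (rule ccontr)
    assume ne: "x \<noteq> x'"
    have "x' \<in> {x, y, z}" unfolding eq2 by simp
    then have 1: "top_diff x x' = top_diff x y" using d ne by auto
    have "x \<in> {x', y', z'}" unfolding eq2[symmetric] by simp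
    then have 2: "top_diff x' x = top_diff x' y'" using d ne by auto
    obtain v where v: "v \<in> {x, y, z}" "v \<noteq> x" "v \<noteq> x'"
      using dist by (cases "x' = y") auto
    then have 3: "top_diff x v = top_diff x y" using d by auto
    have "v \<in> {x', y', z'}" using v(1) unfolding eq2 .
    then have "top_diff x' v = top_diff x' y'" using d v by auto
    with 1 2 3 v ne show False
      using top_diff_same_label[of v x x'] by (metis top_diff_commute less_irrefl)
  qed
  have "{y, z} = {x, y, z} - {x}" using dist by auto
  also have "\<dots> = {x', y', z'} - {x'}" by (metis eq2 x)
  also have "\<dots> = {y', z'}" using dist by auto
  finally show ?thesis using w x by (simp add: doubleton_eq_iff)
qed

text \<open>The swap left open by \<open>caterpillar_unique\<close> is harmless, since
  \<open>y\<close> and \<open>z\<close> have the same bit at \<open>top_diff x y\<close>. Hence the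
  pattern can be read off in any caterpillar order of an edge.\<close>

lemma step_up_caterpillar:
  assumes "{w, x, y, z} \<in> step_up \<phi>" "caterpillar w x y z"
  shows "caterpillar_edge \<phi> w x y z"
proof -
  obtain w' x' y' z' where e: "{w, x, y, z} = {w', x', y', z'}" "caterpillar_edge \<phi> w' x' y' z'"
    using assms(1) unfolding step_up_def by auto
  then have c: "caterpillar w' x' y' z'" by (simp add: caterpillar_edge_def)
  from caterpillar_unique[OF assms(2) c e(1)] consider "w = w'" "x = x'" "y = y'" "z = z'"
    | "w = w'" "x = x'" "y = z'" "z = y'" by blast
  then show ?thesis
  proof cases
    case 1
    then show ?thesis using e(2) by simp
  next
    case 2
    then show ?thesis
      using e(2) caterpillarD[OF c] assms(2) unfolding caterpillar_edge_def
      by (simp add: top_diff_commute[of z' y'])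
  qed
qed

section \<open>The top split of a vertex set\<close>

definition top_label :: "nat set \<Rightarrow> nat \<Rightarrow> bool" where
  "top_label S r \<longleftrightarrow> (\<forall>u\<in>S. \<forall>v\<in>S. u \<noteq> v \<longrightarrow> top_diff u v \<le> r) \<and>
     (\<exists>u\<in>S. \<exists>v\<in>S. u \<noteq> v \<and> top_diff u v = r)"

definition side :: "nat set \<Rightarrow> nat \<Rightarrow> bool \<Rightarrow> nat set" where
  "side S r t = {v \<in> S. bit v r = t}"

lemma top_label_exists:
  assumes "finite S" "2 \<le> card S"
  obtains r where "top_label S r"
proof -
  define D where "D = {top_diff u v | u v. u \<in> S \<and> v \<in> S \<and> u \<noteq> v}"
  have "D \<subseteq> (\<lambda>(u, v). top_diff u v) ` (S \<times> S)" by (auto simp: D_def)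
  then have finD: "finite D" using assms(1) by (meson finite_SigmaI finite_imageI finite_subset)
  obtain u v where "u \<in> S" "v \<in> S" "u \<noteq> v"
    using assms by (metis card_le_Suc0_iff_eq not_less_eq_eq numeral_2_eq_2)
  then have neD: "D \<noteq> {}" by (auto simp: D_def)
  have "top_diff x y \<le> Max D" if "x \<in> S" "y \<in> S" "x \<noteq> y" for x y
    using that finD by (intro Max_ge) (auto simp: D_def)
  moreover obtain p q where "p \<in> S" "q \<in> S" "p \<noteq> q" "top_diff p q = Max D"
    using Max_in[OF finD neD] unfolding D_def by auto
  ultimately have "top_label S (Max D)" unfolding top_label_def by blast
  then show thesis by (rule that)
qed

lemma side_subset: "side S r t \<subseteq> S"
  by (auto simp: side_def)

lemma side_partition: "S = side S r t \<union> side S r (\<not> t)" "side S r t \<inter> side S r (\<not> t) = {}"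
  by (auto simp: side_def)

lemma side_bit: "v \<in> side S r t \<Longrightarrow> bit v r = t"
  by (simp add: side_def)

lemma side_nonempty:
  assumes "top_label S r"
  shows "side S r t \<noteq> {}"
proof -
  obtain u v where "u \<in> S" "v \<in> S" "u \<noteq> v" "top_diff u v = r"
    using assms by (auto simp: top_label_def)
  then have "u \<in> side S r t \<or> v \<in> side S r t"
    using bit_top_diff[of u v] by (auto simp: side_def)
  then show ?thesis by blast
qed

lemma card_side:
  assumes "finite S"
  shows "card S = card (side S r t) + card (side S r (\<not> t))"
  using card_Un_disjoint[of "side S r t" "side S r (\<not> t)"] side_partition[of S r t] assms
  by (metis finite_subset side_subset)

lemma top_diff_same_side:
  assumes "top_label S r" "u \<in> side S r t" "v \<in> side S r t" "u \<noteq> v"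
  shows "top_diff u v < r"
proof -
  have "top_diff u v \<le> r" using assms by (auto simp: top_label_def side_def)
  moreover have "top_diff u v \<noteq> r" using bit_top_diff[OF assms(4)] assms(2,3) by (auto simp: side_def)
  ultimately show ?thesis by simp
qed

lemma top_diff_other_side:
  assumes "top_label S r" "u \<in> side S r t" "v \<in> side S r (\<not> t)"
  shows "top_diff u v = r"
proof -
  have "u \<noteq> v" "bit u r \<noteq> bit v r" using assms(2,3) by (auto simp: side_def)
  moreover from this have "top_diff u v \<le> r" using assms by (auto simp: top_label_def side_def)
  ultimately show ?thesis using bit_above_top_diff[of u v r] by (auto simp: le_less)
qed

text \<open>This is the situation in which \<open>p\<close> leaves the path at \<open>r\<close> and
  \<open>T\<close> continues with turn \<open>t\<close>, so that \<open>p\<close> can be put in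
  front of a path inside \<open>T\<close>.\<close>

definition branch :: "nat \<Rightarrow> nat \<Rightarrow> bool \<Rightarrow> nat set \<Rightarrow> bool" where
  "branch p r t T \<longleftrightarrow> (\<forall>u\<in>T. top_diff p u = r \<and> bit u r = t) \<and>
     (\<forall>u\<in>T. \<forall>v\<in>T. u \<noteq> v \<longrightarrow> top_diff u v < r)"

lemma branchD:
  assumes "branch p r t T" "u \<in> T"
  shows "top_diff p u = r" "bit u r = t" "v \<in> T \<Longrightarrow> u \<noteq> v \<Longrightarrow> top_diff u v < r"
  using assms unfolding branch_def by blast+

lemma branch_subset: "branch p r t T \<Longrightarrow> U \<subseteq> T \<Longrightarrow> branch p r t U"
  unfolding branch_def by blast

lemma branch_side:
  assumes "top_label S r" "p \<in> side S r (\<not> t)"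
  shows "branch p r t (side S r t)"
  unfolding branch_def
proof (intro conjI ballI impI)
  fix u assume u: "u \<in> side S r t"
  show "bit u r = t" using side_bit[OF u] .
  show "top_diff p u = r"
    using top_diff_other_side[OF assms(1) u assms(2)] by (simp add: top_diff_commute[of p])
  show "top_diff u v < r" if "v \<in> side S r t" "u \<noteq> v" for v
    using top_diff_same_side[OF assms(1) u that] .
qed

section \<open>No complete 4-graph on five vertices\<close>

text \<open>Here \<open>aij\<close> is the colour of the \<open>i\<close>-th and \<open>j\<close>-th
  label of a caterpillar on five vertices; dropping either vertex of the last pair gives the same
  pattern, whence four conditions. The first two force \<open>a13 = a14\<close> and
  \<open>a23 = a24\<close>, so \<open>t3\<close> differs from both \<open>t1\<close> and
  \<open>t2\<close>. Then \<open>t1 = t2\<close>, so \<open>a13 \<noteq> a23\<close>, while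
  \<open>a34\<close> would have to stand in the same relation to both.\<close>

lemma edge_pattern_K4_free:
  "\<not> (edge_pattern t1 t2 a12 a13 a23 \<and> edge_pattern t1 t2 a12 a14 a24 \<and>
      edge_pattern t1 t3 a13 a14 a34 \<and> edge_pattern t2 t3 a23 a24 a34)"
  unfolding edge_pattern_def by argo

text \<open>The first vertex of a caterpillar meets the three others at one label; in a 2+2 split no
  vertex does.\<close>

lemma step_up_not_balanced:
  assumes "a \<noteq> a'" "b \<noteq> b'" "top_diff a a' < r" "top_diff b b' < r"
    "top_diff a b = r" "top_diff a b' = r" "top_diff a' b = r" "top_diff a' b' = r"
  shows "{a, a', b, b'} \<notin> step_up \<phi>"
proof
  assume "{a, a', b, b'} \<in> step_up \<phi>"
  then obtain w x y z where eq: "{a, a', b, b'} = {w, x, y, z}" and c: "caterpillar w x y z"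
    unfolding step_up_def caterpillar_edge_def by auto
  have const: "top_diff w u = top_diff w x" if "u \<in> {a, a', b, b'}" "u \<noteq> w" for u
    using that caterpillarD(1,2)[OF c] unfolding eq by auto
  have "w \<in> {a, a', b, b'}" unfolding eq by simp
  moreover have "distinct [a, a', b, b']" using assms by auto
  ultimately show False
    using const[of a] const[of a'] const[of b] const[of b'] assms
    by (auto simp: top_diff_commute[of a' a] top_diff_commute[of b a] top_diff_commute[of b' a]
        top_diff_commute[of b a'] top_diff_commute[of b' a'] top_diff_commute[of b' b])
qed

lemma step_up_K5_free:
  assumes "card S = 5"
  shows "\<not> [S]\<^bsup>4\<^esup> \<subseteq> step_up \<phi>"
proof
  assume sub: "[S]\<^bsup>4\<^esup> \<subseteq> step_up \<phi>"
  have fin: "finite S" using assms card.infinite by fastforce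
  have card2: "2 \<le> card S" using assms by simp
  have sub4: "{u1, u2, u3, u4} \<in> step_up \<phi>"
    if "distinct [u1, u2, u3, u4]" "{u1, u2, u3, u4} \<subseteq> S" for u1 u2 u3 u4
  proof -
    have "{u1, u2, u3, u4} \<in> [S]\<^bsup>4\<^esup>" using that by (simp add: nsets_def)
    then show ?thesis using sub by blast
  qed
  obtain r where r: "top_label S r" using top_label_exists[OF fin card2] .
  \<comment> \<open>A 1+4 split: the four vertices are an edge, hence a caterpillar, and the single
    vertex \<open>v\<close> on top extends it to five vertices.\<close>
  have caterpillar_case: False
    if "card (side S r (\<not> t)) = 1" for t
  proof -
    obtain v where v': "side S r (\<not> t) = {v}" using \<open>card _ = 1\<close> by (auto simp: card_1_singleton_iff)
    define T where "T = side S r t"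
    have br: "branch v r t T" using branch_side[OF r] v' unfolding T_def by blast
    have v: "S = insert v T" "v \<notin> T"
      using side_partition[of S r t] v' by (auto simp: T_def)
    note T = branchD[OF br]
    have "card T = 4" using v assms fin by simp
    then have "T \<in> [S]\<^bsup>4\<^esup>" using side_subset[of S r t] finite_subset[OF _ fin] by (simp add: nsets_def T_def)
    then have "T \<in> step_up \<phi>" using sub by (rule rev_subsetD)
    then obtain w x y z where Teq: "T = {w, x, y, z}" and e: "caterpillar_edge \<phi> w x y z"
      unfolding step_up_def by auto
    then have c: "caterpillar w x y z" by (simp add: caterpillar_edge_def)
    note cD = caterpillarD[OF c]
    have l: "top_diff y z < top_diff x y" "top_diff x y < top_diff w x" "top_diff w x < r"
      "top_diff w y < r" "top_diff x y < r" "y \<noteq> z"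
      using c T(3) cD(4) Teq by (auto simp: caterpillar_def)
    have vr: "top_diff v w = r" "top_diff v x = r" "top_diff v y = r" "top_diff v z = r"
      using T(1) Teq by auto
    have bits: "bit x r = bit w r" using T(2)[of x] T(2)[of w] Teq by auto
    have c1: "caterpillar v w x y" and c2: "caterpillar v w y z" and c3: "caterpillar v x y z"
      using l vr cD by (auto simp: caterpillar_def)
    have "caterpillar_edge \<phi> v w x y" "caterpillar_edge \<phi> v w y z" "caterpillar_edge \<phi> v x y z"
      using c1 c2 c3 cD(4) v(1,2) Teq
      by (auto intro!: step_up_caterpillar sub4)
    with e have "edge_pattern (bit w r) (bit x (top_diff w x)) (\<phi> r (top_diff w x)) (\<phi> r (top_diff x y)) (\<phi> (top_diff w x) (top_diff x y))"
      "edge_pattern (bit w r) (bit x (top_diff w x)) (\<phi> r (top_diff w x)) (\<phi> r (top_diff y z)) (\<phi> (top_diff w x) (top_diff y z))"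
      "edge_pattern (bit w r) (bit y (top_diff x y)) (\<phi> r (top_diff x y)) (\<phi> r (top_diff y z)) (\<phi> (top_diff x y) (top_diff y z))"
      "edge_pattern (bit x (top_diff w x)) (bit y (top_diff x y)) (\<phi> (top_diff w x) (top_diff x y)) (\<phi> (top_diff w x) (top_diff y z)) (\<phi> (top_diff x y) (top_diff y z))"
      using vr cD bits by (simp_all add: caterpillar_edge_def)
    then show False using edge_pattern_K4_free by blast
  qed
  \<comment> \<open>Both sides now have at least two vertices, which yields a 2+2 split.\<close>
  have fin_side: "finite (side S r t)" for t using finite_subset[OF side_subset fin] .
  have "2 \<le> card (side S r t)" for t
    using caterpillar_case[of "\<not> t"] side_nonempty[OF r, of t] fin_side[of t]
      card_gt_0_iff[of "side S r t"] by force
  then have "\<exists>u v. u \<in> side S r t \<and> v \<in> side S r t \<and> u \<noteq> v" for t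
    using fin_side[of t] by (metis card_le_Suc0_iff_eq not_less_eq_eq numeral_2_eq_2)
  then obtain a a' b b' where ab: "a \<in> side S r True" "a' \<in> side S r True" "a \<noteq> a'"
      "b \<in> side S r (\<not> True)" "b' \<in> side S r (\<not> True)" "b \<noteq> b'"
    by meson
  then have "{a, a', b, b'} \<in> step_up \<phi>"
    using side_subset[of S r] side_partition[of S r True] by (intro sub4) auto
  moreover have "{a, a', b, b'} \<notin> step_up \<phi>"
    using ab top_diff_same_side[OF r] top_diff_other_side[OF r]
    by (intro step_up_not_balanced[where r = r]) blast+
  ultimately show False by blast
qed

section \<open>Independent sets\<close>

text \<open>The pairs whose label satisfies \<open>C\<close> form a cograph, where clique number
  times independence number is at least the number of vertices. At a top label of colour
  \<open>k\<close> the sets of colour \<open>k\<close> from both sides unite, and of the two sets of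
  the other colour the larger one is kept.\<close>

lemma colour_split:
  assumes "finite S" "S \<noteq> {}"
  obtains A B where "A \<subseteq> S" "B \<subseteq> S" "card S \<le> card A * card B"
    "\<forall>u\<in>A. \<forall>v\<in>A. u \<noteq> v \<longrightarrow> C (top_diff u v)" "\<forall>u\<in>B. \<forall>v\<in>B. u \<noteq> v \<longrightarrow> \<not> C (top_diff u v)"
proof -
  define P where "P = (\<lambda>c A. \<forall>u\<in>A. \<forall>v\<in>A. u \<noteq> v \<longrightarrow> C (top_diff u v) = c)"
  have "\<exists>F. \<forall>c. F c \<subseteq> S \<and> F c \<noteq> {} \<and> P c (F c) \<and> card S \<le> card (F c) * card (F (\<not> c))"
    using assms
  proof (induction "card S" arbitrary: S rule: less_induct)
    case less
    show ?case
    proof (cases "2 \<le> card S")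
      case False
      then have "card S = 1" using less.prems card_gt_0_iff[of S] by linarith
      then have "is_singleton S" by (simp add: is_singleton_altdef)
      then show ?thesis
        by (intro exI[of _ "\<lambda>_. S"]) (auto simp: P_def is_singleton_def)
    next
      case True
      obtain r where r: "top_label S r" using top_label_exists[OF less.prems(1) True] .
      have fin: "finite (side S r t)" for t using finite_subset[OF side_subset less.prems(1)] .
      have sum: "card S = card (side S r t) + card (side S r (\<not> t))" for t
        using card_side less.prems(1) .
      have pos: "0 < card (side S r t)" for t using side_nonempty[OF r] fin by (simp add: card_gt_0_iff)
      have "\<exists>F. \<forall>c. F c \<subseteq> side S r t \<and> F c \<noteq> {} \<and> P c (F c) \<and>
          card (side S r t) \<le> card (F c) * card (F (\<not> c))" for t
        using less.hyps[of "side S r t"] sum[of t] pos[of "\<not> t"] fin side_nonempty[OF r] by simp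
      then obtain F where F: "\<And>t c. F t c \<subseteq> side S r t" "\<And>t c. F t c \<noteq> {}" "\<And>t c. P c (F t c)"
          "\<And>t c. card (side S r t) \<le> card (F t c) * card (F t (\<not> c))"
        by metis
      have finF: "finite (F t c)" for t c using finite_subset[OF F(1) fin] .
      have FS: "F t c \<subseteq> S" for t c using F(1)[of t c] side_subset[of S r t] by (rule subset_trans)
      define k where "k = C r"
      obtain t where t: "card (F (\<not> t) (\<not> k)) \<le> card (F t (\<not> k))"
        using linear[of "card (F True (\<not> k))" "card (F False (\<not> k))"] by (metis (full_types))
      define G where "G = (\<lambda>c. if c = k then F t k \<union> F (\<not> t) k else F t (\<not> k))"
      have cross: "top_diff u v = r" if "u \<in> F t' k" "v \<in> F (\<not> t') k" for u v t'
        using top_diff_other_side[OF r] F(1) that by blast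
      have "P k (F t k \<union> F (\<not> t) k)"
        using F(3)[of k t] F(3)[of k "\<not> t"] cross[of _ t] cross[of _ "\<not> t"]
        unfolding P_def by (auto simp: k_def)
      moreover have disj: "F t k \<inter> F (\<not> t) k = {}"
        using F(1)[of t k] F(1)[of "\<not> t" k] side_partition(2)[of S r t] by blast
      moreover have "card S \<le> card (F t k \<union> F (\<not> t) k) * card (F t (\<not> k))"
      proof -
        have "card S \<le> card (F t k) * card (F t (\<not> k)) + card (F (\<not> t) k) * card (F (\<not> t) (\<not> k))"
          using sum[of t] F(4)[of t k] F(4)[of "\<not> t" k] by linarith
        also have "\<dots> \<le> card (F t k) * card (F t (\<not> k)) + card (F (\<not> t) k) * card (F t (\<not> k))"
          using t by simp
        finally show ?thesis
          using card_Un_disjoint[OF finF finF disj] by (simp add: algebra_simps)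
      qed
      ultimately have "G c \<subseteq> S \<and> G c \<noteq> {} \<and> P c (G c) \<and> card S \<le> card (G c) * card (G (\<not> c))" for c
        using FS[of t] FS[of "\<not> t"] F(2)[of t] F(3)[of c t]
        by (cases "c = k") (auto simp: G_def mult.commute)
      then show ?thesis by blast
    qed
  qed
  then obtain F where F: "\<And>c. F c \<subseteq> S" "\<And>c. P c (F c)" "\<And>c. card S \<le> card (F c) * card (F (\<not> c))"
    by metis
  show thesis
    by (rule that[of "F True" "F False"]) (use F[of True] F[of False] in \<open>auto simp: P_def\<close>)
qed

section \<open>Combs: caterpillars with constant turn\<close>

text \<open>At every split within \<open>S\<close> the side opposite to \<open>t\<close> holds a
  single vertex: two vertices \<open>y\<close>, \<open>z\<close> there would make a wrong
  turn.\<close>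

definition comb :: "bool \<Rightarrow> nat set \<Rightarrow> bool" where
  "comb t S \<longleftrightarrow> (\<forall>x\<in>S. \<forall>y\<in>S. \<forall>z\<in>S. y \<noteq> z \<and> top_diff y z < top_diff x y \<longrightarrow>
     bit y (top_diff x y) = t)"

lemma comb_subset: "comb t S \<Longrightarrow> T \<subseteq> S \<Longrightarrow> comb t T"
  unfolding comb_def by blast

text \<open>The label \<open>r\<close> between \<open>v\<close> and \<open>K\<close> exceeds all
  labels inside \<open>K\<close>. So the pair \<open>y\<close>, \<open>z\<close> lies in
  \<open>K\<close>, and the only new turn, at \<open>r\<close>, is \<open>t\<close>.\<close>

lemma comb_insert:
  assumes "comb t K" "branch v r t K"
  shows "comb t (insert v K)"
  unfolding comb_def
proof (intro ballI impI)
  fix x y z assume xyz: "x \<in> insert v K" "y \<in> insert v K" "z \<in> insert v K"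
    and lt: "y \<noteq> z \<and> top_diff y z < top_diff x y"
  note K = branchD[OF assms(2)]
  have le: "top_diff u u' \<le> r" if "u \<in> insert v K" "u' \<in> insert v K" "u \<noteq> u'" for u u'
    using that K(1) K(3)[of u u'] by (auto simp: less_imp_le top_diff_commute[of u v])
  have "x \<noteq> y" using lt by auto
  have "top_diff y z \<noteq> r" using le[OF xyz(1,2) \<open>x \<noteq> y\<close>] lt by simp
  then have yz: "y \<in> K" "z \<in> K"
    using lt xyz(2,3) K(1) top_diff_commute by (metis insertE)+
  show "bit y (top_diff x y) = t"
  proof (cases "x = v")
    case True
    then show ?thesis using K(1,2) yz by simp
  next
    case False
    then show ?thesis using assms(1) xyz yz lt by (auto simp: comb_def)
  qed
qed

text \<open>Descend from the top label, always into side \<open>t\<close>, keeping one vertex of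
  each side left behind: these vertices form a comb. Each side left behind is a branch with turn
  \<open>\<not> t\<close>, hence has at most \<open>b\<close> vertices; the single vertex at the end
  is covered by \<open>1 \<le> b\<close>.\<close>

lemma spine:
  assumes "finite S" "S \<noteq> {}"
    and "\<And>x r Y. x \<in> S \<Longrightarrow> Y \<subseteq> S \<Longrightarrow> branch x r (\<not> t) Y \<Longrightarrow> card Y \<le> b"
    and b: "1 \<le> b"
  shows "\<exists>K \<subseteq> S. comb t K \<and> card S \<le> card K * b"
  using assms(1-3)
proof (induction "card S" arbitrary: S rule: less_induct)
  case less
  show ?case
  proof (cases "2 \<le> card S")
    case False
    then have "card S = 1" using less.prems card_gt_0_iff[of S] by linarith
    then have "is_singleton S" by (simp add: is_singleton_altdef)
    then show ?thesis using \<open>card S = 1\<close> b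
      by (intro exI[of _ S]) (auto simp: comb_def is_singleton_def)
  next
    case True
    obtain r where r: "top_label S r" using top_label_exists[OF less.prems(1) True] .
    have fin: "finite (side S r t)" for t using finite_subset[OF side_subset less.prems(1)] .
    have sum: "card S = card (side S r t) + card (side S r (\<not> t))"
      using card_side less.prems(1) .
    have pos: "0 < card (side S r t)" for t using side_nonempty[OF r] fin by (simp add: card_gt_0_iff)
    have "\<exists>K \<subseteq> side S r t. comb t K \<and> card (side S r t) \<le> card K * b"
    proof (rule less.hyps)
      show "card (side S r t) < card S" using sum pos[of "\<not> t"] by simp
      show "card Y \<le> b" if "x \<in> side S r t" "Y \<subseteq> side S r t" "branch x r' (\<not> t) Y" for x r' Y
        using less.prems(3)[of x Y r'] that side_subset[of S r t] by blast
    qed (use fin side_nonempty[OF r] in auto)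
    then obtain K where K: "K \<subseteq> side S r t" "comb t K" "card (side S r t) \<le> card K * b"
      by blast
    obtain x where x: "x \<in> side S r (\<not> (\<not> t))" using side_nonempty[OF r] by blast
    obtain v where v: "v \<in> side S r (\<not> t)" using side_nonempty[OF r] by blast
    have tooth: "card (side S r (\<not> t)) \<le> b"
      using x side_subset[of S r] by (intro less.prems(3)[OF _ _ branch_side[OF r x]]) blast+
    have "comb t (insert v K)"
      using comb_insert[OF K(2) branch_subset[OF branch_side[OF r v] K(1)]] .
    moreover have "v \<notin> K" using K(1) v side_partition(2)[of S r t] by blast
    then have "card (insert v K) = Suc (card K)" using finite_subset[OF K(1) fin] by simp
    then have "card S \<le> card (insert v K) * b" using sum K(3) tooth by simp
    moreover have "insert v K \<subseteq> S" using v K(1) side_subset[of S r] by blast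
    ultimately show ?thesis by blast
  qed
qed

definition labels :: "nat set \<Rightarrow> nat set" where
  "labels S = {top_diff u v | u v. u \<in> S \<and> v \<in> S \<and> u \<noteq> v}"

text \<open>The side \<open>\<not> t\<close> of the top label is a single vertex \<open>v\<close>,
  which adds exactly one label. The clause on two labels feeds the induction: putting
  \<open>v\<close> in front of a path for \<open>b > c\<close> gives one for three labels.\<close>

lemma comb_labels:
  assumes "finite S" "S \<noteq> {}" "comb t S"
  shows "card S = Suc (card (labels S)) \<and> finite (labels S) \<and>
    (\<forall>b\<in>labels S. \<forall>c\<in>labels S. c < b \<longrightarrow>
      (\<exists>x\<in>S. \<exists>y\<in>S. \<exists>z\<in>S. y \<noteq> z \<and> top_diff x y = b \<and> top_diff y z = c)) \<and>
    (\<forall>a\<in>labels S. \<forall>b\<in>labels S. \<forall>c\<in>labels S. c < b \<and> b < a \<longrightarrow>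
      (\<exists>w\<in>S. \<exists>x\<in>S. \<exists>y\<in>S. \<exists>z\<in>S. y \<noteq> z \<and> top_diff w x = a \<and> top_diff x y = b \<and> top_diff y z = c))"
  using assms
proof (induction "card S" arbitrary: S rule: less_induct)
  case less
  show ?case
  proof (cases "2 \<le> card S")
    case False
    then have "card S = 1" using less.prems card_gt_0_iff[of S] by linarith
    then obtain s where "S = {s}" by (auto simp: card_1_singleton_iff)
    then show ?thesis by (auto simp: labels_def)
  next
    case True
    obtain r where r: "top_label S r" using top_label_exists[OF less.prems(1) True] .
    define T where "T = side S r t"
    have finT: "finite T" using finite_subset[OF side_subset less.prems(1)] unfolding T_def .
    have neT: "T \<noteq> {}" using side_nonempty[OF r] unfolding T_def .
    obtain v where v: "v \<in> side S r (\<not> t)" using side_nonempty[OF r] by blast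
    have uniq: "u = v" if "u \<in> side S r (\<not> t)" for u
    proof (rule ccontr)
      assume "u \<noteq> v"
      obtain x where x: "x \<in> T" using neT by blast
      have "top_diff u v < top_diff x u"
        using top_diff_same_side[OF r that v \<open>u \<noteq> v\<close>] top_diff_other_side[OF r _ that] x
        unfolding T_def by simp
      moreover have "x \<in> S" "u \<in> S" "v \<in> S" using x that v side_subset[of S r] unfolding T_def by blast+
      ultimately have "bit u (top_diff x u) = t" using less.prems(3) \<open>u \<noteq> v\<close> unfolding comb_def by blast
      then show False
        using top_diff_other_side[OF r _ that] x side_bit[OF that] unfolding T_def by simp
    qed
    have S: "S = insert v T" "v \<notin> T"
      using side_partition[of S r t] v uniq unfolding T_def by blast+
    have vT: "top_diff v u = r" if "u \<in> T" for u
      using top_diff_other_side[OF r, of u t v] that v unfolding T_def by (simp add: top_diff_commute[of v])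
    have labT: "c < r" if "c \<in> labels T" for c
      using that top_diff_same_side[OF r] unfolding labels_def T_def by blast
    have lab: "labels S = insert r (labels T)"
    proof
      show "labels S \<subseteq> insert r (labels T)"
        unfolding labels_def S(1) using vT by (auto simp: top_diff_commute[of _ v])
      have "r \<in> labels S" using r unfolding top_label_def labels_def by blast
      then show "insert r (labels T) \<subseteq> labels S"
        unfolding labels_def S(1) by blast
    qed
    have IH: "card T = Suc (card (labels T)) \<and> finite (labels T) \<and>
    (\<forall>b\<in>labels T. \<forall>c\<in>labels T. c < b \<longrightarrow>
      (\<exists>x\<in>T. \<exists>y\<in>T. \<exists>z\<in>T. y \<noteq> z \<and> top_diff x y = b \<and> top_diff y z = c)) \<and>
    (\<forall>a\<in>labels T. \<forall>b\<in>labels T. \<forall>c\<in>labels T. c < b \<and> b < a \<longrightarrow>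
      (\<exists>w\<in>T. \<exists>x\<in>T. \<exists>y\<in>T. \<exists>z\<in>T. y \<noteq> z \<and> top_diff w x = a \<and> top_diff x y = b \<and> top_diff y z = c))"
    proof (rule less.hyps)
      show "card T < card S" using S finT by simp
      show "comb t T" using comb_subset[OF less.prems(3)] S(1) by blast
    qed (use finT neT in auto)
    note IH2 = IH[THEN conjunct2, THEN conjunct2, THEN conjunct1, rule_format]
    note IH3 = IH[THEN conjunct2, THEN conjunct2, THEN conjunct2, rule_format]
    have "r \<notin> labels T" using labT by blast
    moreover have "card S = Suc (card T)" using S finT by simp
    ultimately have 1: "card S = Suc (card (labels S)) \<and> finite (labels S)"
      using IH by (simp add: lab)
    have 2: "\<exists>x\<in>S. \<exists>y\<in>S. \<exists>z\<in>S. y \<noteq> z \<and> top_diff x y = b \<and> top_diff y z = c"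
      if bc: "b \<in> labels S" "c \<in> labels S" "c < b" for b c
    proof -
      have c: "c \<in> labels T" using bc unfolding lab by (auto dest: labT)
      show ?thesis
      proof (cases "b = r")
        case True
        from c obtain y z where "y \<in> T" "z \<in> T" "y \<noteq> z" "top_diff y z = c" unfolding labels_def by blast
        then show ?thesis using True vT[of y] S(1) by blast
      next
        case False
        then have "b \<in> labels T" using bc unfolding lab by blast
        then obtain x y z where "x \<in> T" "y \<in> T" "z \<in> T" "y \<noteq> z" "top_diff x y = b" "top_diff y z = c"
          using IH2[OF _ c bc(3)] by blast
        then show ?thesis using S(1) by blast
      qed
    qed
    have 3: "\<exists>w\<in>S. \<exists>x\<in>S. \<exists>y\<in>S. \<exists>z\<in>S. y \<noteq> z \<and> top_diff w x = a \<and> top_diff x y = b \<and> top_diff y z = c"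
      if abc: "a \<in> labels S" "b \<in> labels S" "c \<in> labels S" "c < b" "b < a" for a b c
    proof -
      have bc: "b \<in> labels T" "c \<in> labels T" using abc unfolding lab by (auto dest: labT)
      show ?thesis
      proof (cases "a = r")
        case True
        obtain x y z where "x \<in> T" "y \<in> T" "z \<in> T" "y \<noteq> z" "top_diff x y = b" "top_diff y z = c"
          using IH2[OF bc abc(4)] by blast
        then show ?thesis using True vT[of x] S(1) by blast
      next
        case False
        then have "a \<in> labels T" using abc unfolding lab by blast
        then obtain w x y z where "w \<in> T" "x \<in> T" "y \<in> T" "z \<in> T" "y \<noteq> z"
            "top_diff w x = a" "top_diff x y = b" "top_diff y z = c"
          using IH3[OF _ bc] abc(4,5) by blast
        then show ?thesis using S(1) by blast
      qed
    qed
    show ?thesis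
    proof (intro conjI ballI impI)
      show "card S = Suc (card (labels S))" "finite (labels S)" using 1 by auto
    qed (use 2 3 in auto)
  qed
qed

section \<open>Size of sets without edges\<close>

definition step_up_free :: "(nat \<Rightarrow> nat \<Rightarrow> bool) \<Rightarrow> nat set \<Rightarrow> bool" where
  "step_up_free \<phi> S \<longleftrightarrow> (\<forall>w\<in>S. \<forall>x\<in>S. \<forall>y\<in>S. \<forall>z\<in>S. \<not> caterpillar_edge \<phi> w x y z)"

lemma step_up_free_subset: "step_up_free \<phi> S \<Longrightarrow> T \<subseteq> S \<Longrightarrow> step_up_free \<phi> T"
  unfolding step_up_free_def by blast

text \<open>Reading \<open>\<phi> a b\<close> for \<open>a > b\<close> as the direction of an arc,
  this is a directed triangle in \<open>L\<close>.\<close>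

definition cyclic_triple :: "(nat \<Rightarrow> nat \<Rightarrow> bool) \<Rightarrow> nat set \<Rightarrow> bool" where
  "cyclic_triple \<phi> L \<longleftrightarrow> (\<exists>a\<in>L. \<exists>b\<in>L. \<exists>c\<in>L. c < b \<and> b < a \<and> \<phi> a b = \<phi> b c \<and> \<phi> a b \<noteq> \<phi> a c)"

text \<open>More than \<open>M\<close> vertices give at least \<open>M\<close> labels, hence a
  cyclic triple. A path of the comb realises it, and as both turns are \<open>t\<close>, that path
  is an edge.\<close>

lemma card_free_comb:
  assumes fin: "finite S" and ne: "S \<noteq> {}" and comb: "comb t S" and free: "step_up_free \<phi> S"
    and cyc: "\<And>L. L \<subseteq> labels S \<Longrightarrow> card L = M \<Longrightarrow> cyclic_triple \<phi> L"
  shows "card S \<le> M"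
proof (rule ccontr)
  note * = comb_labels[OF fin ne comb]
  assume "\<not> card S \<le> M"
  then have "M \<le> card (labels S)" using * by simp
  then obtain L where L: "L \<subseteq> labels S" "card L = M" using obtain_subset_with_card_n by metis
  obtain a b c where abc: "a \<in> labels S" "b \<in> labels S" "c \<in> labels S" "c < b" "b < a"
      "\<phi> a b = \<phi> b c" "\<phi> a b \<noteq> \<phi> a c"
    using cyc[OF L] L(1) unfolding cyclic_triple_def by blast
  obtain w x y z where wxyz: "w \<in> S" "x \<in> S" "y \<in> S" "z \<in> S" "y \<noteq> z"
      "top_diff w x = a" "top_diff x y = b" "top_diff y z = c"
    using *[THEN conjunct2, THEN conjunct2, THEN conjunct2, rule_format, OF abc(1-3)] abc(4,5) by blast
  have cat: "caterpillar w x y z" using wxyz abc by (auto simp: caterpillar_def)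
  have "bit y b = t" using comb wxyz abc unfolding comb_def by auto
  moreover have "x \<noteq> y" using caterpillarD(4)[OF cat] by auto
  then have "bit x a = t" using comb wxyz abc unfolding comb_def by auto
  ultimately have "caterpillar_edge \<phi> w x y z"
    using cat abc wxyz unfolding caterpillar_edge_def edge_pattern_def by simp
  then show False using free wxyz unfolding step_up_free_def by blast
qed

text \<open>Freeness together with \<open>p\<close> fixes the colour of \<open>bc\<close> whenever the turn at \<open>b\<close> is \<open>\<not> t\<close>; this fixes the colours
  below a turn \<open>\<not> t\<close> followed by a turn \<open>t\<close>, and a third turn \<open>\<not> t\<close> then produces an edge.\<close>

lemma no_alternating_path:
  assumes free: "step_up_free \<phi> (insert p T)"
    and branch: "branch p r t T"
    and col: "\<And>u u'. u \<in> T \<Longrightarrow> u' \<in> T \<Longrightarrow> u \<noteq> u' \<Longrightarrow> \<phi> r (top_diff u u') = k"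
    and T: "v \<in> T" "w \<in> T" "x \<in> T" "y \<in> T" "z \<in> T"
    and cat: "caterpillar v w x y" "caterpillar w x y z"
    and turns: "bit w (top_diff v w) = (\<not> t)" "bit x (top_diff w x) = t" "bit y (top_diff x y) = (\<not> t)"
  shows False
proof -
  note p = branchD[OF branch]
  have pat: "\<not> edge_pattern (bit f (top_diff e f)) (bit g (top_diff f g))
      (\<phi> (top_diff e f) (top_diff f g)) (\<phi> (top_diff e f) (top_diff g h)) (\<phi> (top_diff f g) (top_diff g h))"
    if "caterpillar e f g h" "e \<in> insert p T" "f \<in> T" "g \<in> T" "h \<in> T" for e f g h
    using free that unfolding step_up_free_def caterpillar_edge_def by blast
  note c1 = caterpillarD[OF cat(1)] and c2 = caterpillarD[OF cat(2)]
  have l: "y \<noteq> z" "top_diff y z < top_diff x y" "top_diff x y < top_diff w x" "top_diff w x < top_diff v w"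
    using cat unfolding caterpillar_def by auto
  have cat3: "caterpillar v w y z" "caterpillar v x y z"
    using l c1 c2 by (auto simp: caterpillar_def)
  \<comment> \<open>In front of the path, \<open>p\<close> contributes turn \<open>t\<close> at
    \<open>r\<close> and two colours equal to \<open>k\<close>. The turns differ, so only the last
    colour can prevent an edge, and it is thereby fixed.\<close>
  have away: "(\<phi> (top_diff f g) (top_diff g h) = k) = t"
    if "f \<in> T" "g \<in> T" "h \<in> T" "g \<noteq> h" "top_diff g h < top_diff f g" "bit g (top_diff f g) = (\<not> t)" for f g h
  proof -
    note fk = fork[OF that(4,5)]
    have "caterpillar p f g h" using that p(1,3) fk by (auto simp: caterpillar_def)
    from pat[OF this] that col p fk show ?thesis by (auto simp: edge_pattern_def)
  qed
  have 1: "(\<phi> (top_diff v w) (top_diff w x) = k) = t"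
    using away[of v w x] T turns l c1 c2 by auto
  have 2: "(\<phi> (top_diff v w) (top_diff x y) = k) = t"
    using away[of v x y] T turns l c1 c2 by auto
  have 3: "(\<phi> (top_diff v w) (top_diff y z) = k) = t"
    using away[of v y z] T turns l c1 c2 by auto
  have 4: "(\<phi> (top_diff x y) (top_diff y z) = k) = t"
    using away[of x y z] T turns l c1 c2 by auto
  \<comment> \<open>By 1 to 3 the colours seen from \<open>top_diff v w\<close> coincide. Thus 5 and
    6 force both colours from \<open>top_diff w x\<close> downwards to be \<open>\<not> k\<close>,
    and then 7 contradicts 4.\<close>
  have 5: "\<not> edge_pattern (\<not> t) t (\<phi> (top_diff v w) (top_diff w x)) (\<phi> (top_diff v w) (top_diff x y)) (\<phi> (top_diff w x) (top_diff x y))"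
    using pat[OF cat(1)] T turns by simp
  have 6: "\<not> edge_pattern (\<not> t) t (\<phi> (top_diff v w) (top_diff w x)) (\<phi> (top_diff v w) (top_diff y z)) (\<phi> (top_diff w x) (top_diff y z))"
    using pat[OF cat3(1)] T turns c1 c2 by simp
  have 7: "\<not> edge_pattern t (\<not> t) (\<phi> (top_diff w x) (top_diff x y)) (\<phi> (top_diff w x) (top_diff y z)) (\<phi> (top_diff x y) (top_diff y z))"
    using pat[OF cat(2)] T turns by simp
  show False
    using 1 2 3 4 5 6 7 unfolding edge_pattern_def by argo
qed

text \<open>Apply \<open>spine\<close> twice: first along turns \<open>t\<close>, then inside each
  tooth along turns \<open>\<not> t\<close>. The teeth of the teeth are combs themselves, so three
  combs of size at most \<open>M\<close> multiply.\<close>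

lemma card_unicoloured:
  assumes fin: "finite T" and M: "1 \<le> M" and free: "step_up_free \<phi> (insert p T)"
    and branch: "branch p r t T"
    and col: "\<And>u u'. u \<in> T \<Longrightarrow> u' \<in> T \<Longrightarrow> u \<noteq> u' \<Longrightarrow> \<phi> r (top_diff u u') = k"
    and cyc: "\<And>L. L \<subseteq> labels T \<Longrightarrow> card L = M \<Longrightarrow> cyclic_triple \<phi> L"
  shows "card T \<le> M ^ 3"
proof (cases "T = {}")
  case False
  have comb_bound: "card K \<le> M" if "K \<subseteq> T" "comb t' K" for K t'
  proof (cases "K = {}")
    case False
    show ?thesis
    proof (rule card_free_comb[OF finite_subset[OF that(1) fin] False that(2)])
      show "step_up_free \<phi> K" using step_up_free_subset[OF free] that(1) by blast
      have "labels K \<subseteq> labels T" using that(1) unfolding labels_def by blast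
      then show "cyclic_triple \<phi> L" if "L \<subseteq> labels K" "card L = M" for L using cyc that by blast
    qed
  qed simp
  have tooth: "card Y \<le> M ^ 2"
    if Y: "v \<in> T" "Y \<subseteq> T" "branch v a (\<not> t) Y" for v a Y
  proof (cases "Y = {}")
    case False
    have finY: "finite Y" using finite_subset[OF Y(2) fin] .
    \<comment> \<open>A turn \<open>\<not> t\<close> inside \<open>Z\<close>, preceded by
      \<open>w\<close> and \<open>v\<close>, would complete the alternating path that
      \<open>no_alternating_path\<close> forbids.\<close>
    have tooth2: "card Z \<le> M"
      if Z: "w \<in> Y" "Z \<subseteq> Y" "branch w b (\<not> (\<not> t)) Z" for w b Z
    proof (rule comb_bound)
      show "comb t Z"
        unfolding comb_def
      proof (intro ballI impI, rule ccontr)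
        fix x y z assume xyz: "x \<in> Z" "y \<in> Z" "z \<in> Z" "y \<noteq> z \<and> top_diff y z < top_diff x y"
          and bit: "bit y (top_diff x y) \<noteq> t"
        have ne: "x \<noteq> y" using xyz(4) by auto
        have x: "top_diff w x = b" "bit x b = t" "top_diff x y < b"
          using branchD[OF Z(3) xyz(1)] xyz(2) ne by auto
        have "b \<noteq> 0" using x by auto
        then have "w \<noteq> x" using x(1) by auto
        then have w: "top_diff v w = a" "bit w a = (\<not> t)" "top_diff w x < a"
          using branchD[OF Y(3) Z(1)] Z(2) xyz(1) by auto
        show False
          by (rule no_alternating_path[OF free branch col, of v w x y z])
            (use xyz x w bit ne Y(1,2) Z(1,2) \<open>w \<noteq> x\<close> in \<open>auto simp: caterpillar_def\<close>)
      qed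
      show "Z \<subseteq> T" using Z(2) Y(2) by blast
    qed
    have "\<exists>K \<subseteq> Y. comb (\<not> t) K \<and> card Y \<le> card K * M"
      by (rule spine[OF finY False _ M]) (rule tooth2)
    then obtain K where K: "K \<subseteq> Y" "comb (\<not> t) K" "card Y \<le> card K * M" by blast
    have "card K * M \<le> M * M" using comb_bound[OF _ K(2)] K(1) Y(2) by (intro mult_right_mono) auto
    with K(3) have "card Y \<le> M * M" by (rule order_trans)
    then show ?thesis by (simp only: power2_eq_square)
  qed simp
  have "\<exists>K \<subseteq> T. comb t K \<and> card T \<le> card K * M ^ 2"
    by (rule spine[OF fin False _ one_le_power[OF M]]) (rule tooth)
  then obtain K where K: "K \<subseteq> T" "comb t K" "card T \<le> card K * M ^ 2" by blast
  have "card K * M ^ 2 \<le> M * M ^ 2" using comb_bound[OF K(1,2)] by (rule mult_right_mono) simp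
  with K(3) have "card T \<le> M * M ^ 2" by (rule order_trans)
  then show ?thesis by (simp add: power3_eq_cube power2_eq_square mult.assoc)
qed simp

text \<open>Seen from any vertex \<open>p\<close> on the other side of \<open>r\<close>, each side
  is a branch, so \<open>card_unicoloured\<close> bounds both sets of \<open>colour_split\<close>
  for the colour towards \<open>r\<close>.\<close>

lemma card_step_up_free:
  assumes fin: "finite S" and M: "1 \<le> M" and free: "step_up_free \<phi> S"
    and cyc: "\<And>L. L \<subseteq> labels S \<Longrightarrow> card L = M \<Longrightarrow> cyclic_triple \<phi> L"
  shows "card S \<le> 2 * M ^ 6"
proof (cases "2 \<le> card S")
  case False
  moreover have "1 \<le> M ^ 6" using M by (rule one_le_power)
  ultimately show ?thesis by linarith
next
  case True
  obtain r where r: "top_label S r" using top_label_exists[OF fin True] .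
  have side_bound: "card (side S r t) \<le> M ^ 6" for t
  proof -
    have fin': "finite (side S r t)" using finite_subset[OF side_subset fin] .
    obtain p where p: "p \<in> side S r (\<not> t)" using side_nonempty[OF r] by blast
    have uni: "card T \<le> M ^ 3" if T: "T \<subseteq> side S r t"
      and col: "\<And>u v. u \<in> T \<Longrightarrow> v \<in> T \<Longrightarrow> u \<noteq> v \<Longrightarrow> \<phi> r (top_diff u v) = k" for T k
    proof (rule card_unicoloured[OF finite_subset[OF T fin'] M])
      have TS: "T \<subseteq> S" "p \<in> S" using T p side_subset[of S r] by blast+
      show "step_up_free \<phi> (insert p T)" using step_up_free_subset[OF free] TS by blast
      show "branch p r t T" using branch_subset[OF branch_side[OF r p] T] .
      show "\<phi> r (top_diff u v) = k" if "u \<in> T" "v \<in> T" "u \<noteq> v" for u v using col that .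
      have "labels T \<subseteq> labels S" using TS unfolding labels_def by blast
      then show "cyclic_triple \<phi> L" if "L \<subseteq> labels T" "card L = M" for L using cyc that by blast
    qed
    obtain A B where AB: "A \<subseteq> side S r t" "B \<subseteq> side S r t" "card (side S r t) \<le> card A * card B"
        "\<forall>u\<in>A. \<forall>v\<in>A. u \<noteq> v \<longrightarrow> \<phi> r (top_diff u v)" "\<forall>u\<in>B. \<forall>v\<in>B. u \<noteq> v \<longrightarrow> \<not> \<phi> r (top_diff u v)"
      using colour_split[OF fin' side_nonempty[OF r], of "\<phi> r"] .
    have "card A * card B \<le> M ^ 3 * M ^ 3"
      by (rule mult_mono) (use uni[OF AB(1), of True] uni[OF AB(2), of False] AB(4,5) in auto)
    also have "\<dots> = M ^ 6" by (simp flip: power_add)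
    finally show ?thesis using AB(3) by simp
  qed
  show ?thesis using card_side[OF fin, of r True] side_bound[of True] side_bound[of False] by simp
qed

section \<open>A tournament without large transitive subtournaments\<close>

text \<open>Place \<open>x\<close> after the elements related to it and before the rest. Totality
  relates \<open>x\<close> to the rest, and transitivity through \<open>x\<close> orders the two
  parts.\<close>

lemma sorted_list_of_tournament:
  assumes "finite L"
    and "\<And>u v. u \<in> L \<Longrightarrow> v \<in> L \<Longrightarrow> u \<noteq> v \<Longrightarrow> R u v \<or> R v u"
    and "\<And>u v w. u \<in> L \<Longrightarrow> v \<in> L \<Longrightarrow> w \<in> L \<Longrightarrow> distinct [u, v, w] \<Longrightarrow> R u v \<Longrightarrow> R v w \<Longrightarrow> R u w"
  shows "\<exists>xs. set xs = L \<and> distinct xs \<and> sorted_wrt R xs"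
  using assms
proof (induction L rule: finite_induct)
  case (insert x L)
  have "\<exists>xs. set xs = L \<and> distinct xs \<and> sorted_wrt R xs"
    by (rule insert.IH) (use insert.prems in blast)+
  then obtain xs where xs: "set xs = L" "distinct xs" "sorted_wrt R xs" by blast
  define ys where "ys = filter (\<lambda>y. R y x) xs @ x # filter (\<lambda>y. \<not> R y x) xs"
  have "R x y" if "y \<in> L" "\<not> R y x" for y
    using insert.prems(1)[of x y] insert.hyps(2) that by auto
  then have "R y z" if "y \<in> L" "R y x" "z \<in> L" "\<not> R z x" for y z
    using insert.prems(2)[of y x z] insert.hyps(2) that by auto
  then have "sorted_wrt R ys"
    using xs \<open>\<And>y. y \<in> L \<Longrightarrow> \<not> R y x \<Longrightarrow> R x y\<close>
    unfolding ys_def by (auto simp: sorted_wrt_append sorted_wrt_filter)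
  moreover have "set ys = insert x L" "distinct ys"
    using xs insert.hyps(2) unfolding ys_def by auto
  ultimately show ?case by blast
qed simp

text \<open>A set without cyclic triple is a transitive subtournament, which is determined by its list of
  vertices in order; there are fewer such lists than needed to spoil every tournament.\<close>

lemma ex_tournament_cyclic_triples:
  "\<exists>\<phi>. \<forall>L. L \<subseteq> {..<2 ^ m} \<and> card L = 2 * m + 2 \<longrightarrow> cyclic_triple \<phi> L"
proof -
  define N :: nat where "N = 2 ^ m"
  define M where "M = 2 * m + 2"
  define E where "E = [{..<N}]\<^bsup>2\<^esup>"
  \<comment> \<open>\<open>A\<close> collects the pairs whose arc points from the larger to the
    smaller label; all other arcs point upwards.\<close>
  define R where "R = (\<lambda>(A :: nat set set) u v. ({u, v} \<in> A) = (v < u))"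
  define I where "I = {xs. set xs \<subseteq> {..<N} \<and> length xs = M \<and> distinct xs}"
  define Bad where "Bad = (\<lambda>xs. {A \<in> Pow E. sorted_wrt (R A) xs})"
  have finE: "finite E" unfolding E_def by (simp add: finite_imp_finite_nsets)
  have finL: "finite {xs. set xs \<subseteq> {..<N} \<and> length xs = M}" by (simp add: finite_lists_length_eq)
  have I_sub: "I \<subseteq> {xs. set xs \<subseteq> {..<N} \<and> length xs = M}" unfolding I_def by blast
  have finI: "finite I" using finite_subset[OF I_sub finL] .
  have cardI: "card I \<le> N ^ M"
    using card_mono[OF finL I_sub] card_lists_length_eq[of "{..<N}" M] by simp
  have bad: "card (Bad xs) * 2 ^ (M choose 2) \<le> 2 ^ card E" if "xs \<in> I" for xs
  proof -
    define Q where "Q = [set xs]\<^bsup>2\<^esup>"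
    have xs: "set xs \<subseteq> {..<N}" "length xs = M" "distinct xs" using that unfolding I_def by auto
    have QE: "Q \<subseteq> E" unfolding Q_def E_def using xs(1) by (rule nsets_mono)
    have cardQ: "card Q = M choose 2"
      unfolding Q_def using xs by (simp add: card_nsets distinct_card)
    have det: "(e \<in> A) = (e \<in> B)" if "A \<in> Bad xs" "B \<in> Bad xs" "e \<in> Q" for A B e
    proof -
      obtain u v where e: "e = {u, v}" "u \<in> set xs" "v \<in> set xs"
        using \<open>e \<in> Q\<close> unfolding Q_def by (auto simp: nsets_def card_2_iff)
      moreover have "u \<noteq> v" using \<open>e \<in> Q\<close> e(1) unfolding Q_def by (auto simp: nsets_def)
      ultimately obtain i j where ij: "i < length xs" "j < length xs" "xs ! i = u" "xs ! j = v" "i \<noteq> j"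
        by (metis in_set_conv_nth)
      have R: "R C (xs ! k) (xs ! l)" if "C \<in> Bad xs" "k < l" "l < length xs" for C k l
        using that sorted_wrt_nth_less unfolding Bad_def by blast
      show ?thesis
      proof (cases "i < j")
        case True
        then show ?thesis using R[of A i j] R[of B i j] that ij e unfolding R_def by auto
      next
        case False
        then show ?thesis using R[of A j i] R[of B j i] that ij e
          unfolding R_def by (auto simp: insert_commute)
      qed
    qed
    \<comment> \<open>A sorted list fixes all arcs among its members, so only the pairs outside
      \<open>Q\<close> remain free.\<close>
    have "inj_on (\<lambda>A. A - Q) (Bad xs)"
    proof (rule inj_onI)
      fix A B assume AB: "A \<in> Bad xs" "B \<in> Bad xs" "A - Q = B - Q"
      then show "A = B" using det[OF AB(1,2)] by blast
    qed
    moreover have "(\<lambda>A. A - Q) ` Bad xs \<subseteq> Pow (E - Q)" unfolding Bad_def by blast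
    ultimately have "card (Bad xs) \<le> card (Pow (E - Q))"
      using finE by (meson card_inj_on_le finite_Diff finite_Pow_iff)
    also have "\<dots> = 2 ^ (card E - (M choose 2))"
      using finE QE cardQ by (simp add: card_Pow card_Diff_subset finite_subset)
    finally have "card (Bad xs) * 2 ^ (M choose 2) \<le> 2 ^ (card E - (M choose 2)) * 2 ^ (M choose 2)"
      by simp
    also have "\<dots> = 2 ^ card E"
      using card_mono[OF finE QE] cardQ by (simp flip: power_add)
    finally show ?thesis .
  qed
  have "card (\<Union>(Bad ` I)) * 2 ^ (M choose 2) \<le> (\<Sum>xs\<in>I. card (Bad xs)) * 2 ^ (M choose 2)"
    using card_UN_le[OF finI] by simp
  also have "\<dots> \<le> card I * 2 ^ card E"
    using sum_bounded_above[of I "\<lambda>xs. card (Bad xs) * 2 ^ (M choose 2)"] bad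
    by (simp add: sum_distrib_right)
  also have "\<dots> \<le> N ^ M * 2 ^ card E" using cardI by simp
  also have "\<dots> < 2 ^ (M choose 2) * 2 ^ card E"
  proof -
    \<comment> \<open>The choice \<open>M = 2 * m + 2\<close> pays off here: the exponent exceeds
      that of the number of lists by \<open>m + 1\<close>.\<close>
    have "(M choose 2) = m * M + (m + 1)"
      unfolding choose_two M_def by (simp add: algebra_simps)
    moreover have "N ^ M = 2 ^ (m * M)" unfolding N_def by (simp flip: power_mult)
    ultimately have "N ^ M < 2 ^ (M choose 2)"
      by (simp only:) (rule power_strict_increasing, simp_all)
    then show ?thesis by simp
  qed
  finally have "card (\<Union>(Bad ` I)) < card (Pow E)" using finE by (simp add: card_Pow mult.commute)
  then have "\<not> Pow E \<subseteq> \<Union>(Bad ` I)"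
    using card_mono[of "\<Union>(Bad ` I)" "Pow E"] finI finE unfolding Bad_def by fastforce
  then obtain A where A: "A \<subseteq> E" "\<And>xs. xs \<in> I \<Longrightarrow> \<not> sorted_wrt (R A) xs"
    unfolding Bad_def by blast
  have "cyclic_triple (\<lambda>a b. {a, b} \<in> A) L" if L: "L \<subseteq> {..<N}" "card L = M" for L
  proof (rule ccontr)
    assume acyclic: "\<not> cyclic_triple (\<lambda>a b. {a, b} \<in> A) L"
    \<comment> \<open>In a tournament a failure of transitivity is a directed triangle. As
      \<open>cyclic_triple\<close> speaks of decreasing labels, all six orders of \<open>u\<close>,
      \<open>v\<close>, \<open>w\<close> are instantiated.\<close>
    have trans: "R A u w" if "u \<in> L" "v \<in> L" "w \<in> L" "distinct [u, v, w]" "R A u v" "R A v w" for u v w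
    proof -
      have no: "\<not> (c < b \<and> b < a \<and> ({a, b} \<in> A) = ({b, c} \<in> A) \<and> ({a, b} \<in> A) \<noteq> ({a, c} \<in> A))"
        if "a \<in> L" "b \<in> L" "c \<in> L" for a b c
        using acyclic that unfolding cyclic_triple_def by blast
      have comm: "{v, u} = {u, v}" "{w, u} = {u, w}" "{w, v} = {v, w}" by auto
      show ?thesis
        using no[of u v w] no[of u w v] no[of v u w] no[of v w u] no[of w u v] no[of w v u] that
        unfolding R_def comm
        by (cases u v rule: linorder_cases; cases v w rule: linorder_cases;
            cases u w rule: linorder_cases) simp_all
    qed
    have total: "R A u v \<or> R A v u" if "u \<noteq> v" for u v
      using that unfolding R_def by (auto simp: insert_commute)
    have "finite L" using L(1) finite_subset by blast
    then obtain xs where xs: "set xs = L" "distinct xs" "sorted_wrt (R A) xs"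
      using sorted_list_of_tournament[of L "R A"] trans total by blast
    moreover have "length xs = M" using xs L(2) distinct_card by fastforce
    ultimately show False using A(2)[of xs] L(1) unfolding I_def by blast
  qed
  then show ?thesis unfolding N_def M_def by blast
qed

section \<open>The lower bound\<close>

lemma ramsey_property_ramsey_number: "ramsey_property k s n (ramsey_number k s n)"
  unfolding ramsey_number_def by (rule LeastI_ex[OF ex_ramsey_property])

text \<open>The hypergraph without edges already needs this many vertices, as either alternative
  yields a subset of size \<open>s\<close> or \<open>n\<close>. This serves the small
  \<open>n\<close> in the final estimate.\<close>

lemma ramsey_number_ge_min: "min s n \<le> ramsey_number k s n"
proof -
  let ?r = "ramsey_number k s n"
  have "contains_complete k s {..<?r} {} \<or> (\<exists>S. independent_set {..<?r} {} S \<and> card S = n)"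
    using ramsey_property_ramsey_number[of k s n] unfolding ramsey_property_def kgraph_def by simp
  then obtain S where "S \<subseteq> {..<?r}" "card S = s \<or> card S = n"
    unfolding contains_complete_def independent_set_def by blast
  then show ?thesis using card_mono[of "{..<?r}" S] by auto
qed

lemma ramsey_number_step_up:
  assumes "2 * (2 * m + 2) ^ 6 < n"
  shows "2 ^ 2 ^ m < ramsey_number 4 5 n"
proof (rule ccontr)
  let ?r = "ramsey_number 4 5 n"
  assume "\<not> 2 ^ 2 ^ m < ?r"
  then have r: "?r \<le> 2 ^ 2 ^ m" by simp
  obtain \<phi> where \<phi>: "\<And>L. L \<subseteq> {..<2 ^ m} \<Longrightarrow> card L = 2 * m + 2 \<Longrightarrow> cyclic_triple \<phi> L"
    using ex_tournament_cyclic_triples[of m] by blast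
  \<comment> \<open>Restricting to the first \<open>?r \<le> 2 ^ 2 ^ m\<close> vertices keeps all
    labels below \<open>2 ^ m\<close>, where the tournament is under control.\<close>
  let ?E = "step_up \<phi> \<inter> [{..<?r}]\<^bsup>4\<^esup>"
  have "contains_complete 4 5 {..<?r} ?E \<or> (\<exists>S. independent_set {..<?r} ?E S \<and> card S = n)"
    using ramsey_property_ramsey_number[of 4 5 n] unfolding ramsey_property_def kgraph_def by simp
  moreover have "\<not> contains_complete 4 5 {..<?r} ?E"
    using step_up_K5_free unfolding contains_complete_def by blast
  ultimately obtain S where S: "independent_set {..<?r} ?E S" "card S = n" by blast
  have sub: "S \<subseteq> {..<?r}" using S(1) unfolding independent_set_def by blast
  have "card S \<le> 2 * (2 * m + 2) ^ 6"
  proof (rule card_step_up_free)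
    show "finite S" using sub finite_subset by blast
    show "step_up_free \<phi> S"
      unfolding step_up_free_def
    proof (intro ballI notI)
      fix w x y z assume wxyz: "w \<in> S" "x \<in> S" "y \<in> S" "z \<in> S" and e: "caterpillar_edge \<phi> w x y z"
      then have "distinct [w, x, y, z]" using caterpillarD(4) unfolding caterpillar_edge_def by blast
      then have "{w, x, y, z} \<in> [{..<?r}]\<^bsup>4\<^esup>" using wxyz sub by (auto simp: nsets_def)
      moreover have "{w, x, y, z} \<in> step_up \<phi>" using e unfolding step_up_def by blast
      ultimately have "\<not> {w, x, y, z} \<subseteq> S" using S(1) unfolding independent_set_def by blast
      then show False using wxyz by simp
    qed
    have "labels S \<subseteq> {..<2 ^ m}"
    proof
      fix i assume "i \<in> labels S"
      then obtain u v where uv: "u \<in> S" "v \<in> S" "u \<noteq> v" "i = top_diff u v" unfolding labels_def by blast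
      moreover have "u < 2 ^ 2 ^ m" "v < 2 ^ 2 ^ m" using uv(1,2) sub r by auto
      ultimately show "i \<in> {..<2 ^ m}" using top_diff_bound by simp
    qed
    then show "cyclic_triple \<phi> L" if "L \<subseteq> labels S" "card L = 2 * m + 2" for L using \<phi> that by blast
  qed simp
  then show False using S(2) assms by simp
qed

theorem theorem1p2:
  shows "\<exists>c::real. c > 0 \<and>
    (\<forall>n::nat. n \<ge> 5 \<longrightarrow>
      real (ramsey_number 4 5 n) \<ge> 2 powr (2 powr (c * real n powr (1/7))))"
proof (intro exI[of _ "1/10"] conjI allI impI)
  fix n :: nat assume n: "5 \<le> n"
  define x where "x = 1/10 * real n powr (1/7)"
  show "2 powr (2 powr (1/10 * real n powr (1/7))) \<le> real (ramsey_number 4 5 n)"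
    unfolding x_def[symmetric]
  \<comment> \<open>For \<open>x \<le> 1\<close> the bound is at most 4, below the trivial lower
    bound 5.\<close>
  proof (cases "x \<le> 1")
    case True
    then have "2 powr x \<le> (2::real)" using powr_mono[of x 1 2] by simp
    then have "2 powr (2 powr x) \<le> (2::real) powr 2" by (intro powr_mono) auto
    also have "\<dots> = 4" by simp
    also have "\<dots> \<le> real (ramsey_number 4 5 n)" using ramsey_number_ge_min[of 5 n 4] n by simp
    finally show "2 powr (2 powr x) \<le> real (ramsey_number 4 5 n)" .
  next
    case False
    define m where "m = nat \<lceil>x\<rceil>"
    have m: "x \<le> real m" "real m \<le> x + 1" using False unfolding m_def by linarith+
    have x7: "x ^ 7 = real n / 10 ^ 7"
      using n unfolding x_def by (simp add: power_mult_distrib power_divide powr_power)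
    \<comment> \<open>From \<open>m \<le> x + 1\<close> and \<open>x > 1\<close> follows
      \<open>2 * m + 2 \<le> 6 * x\<close>. The constant \<open>1/10\<close> makes
      \<open>n = 10 ^ 7 * x ^ 7\<close>, and \<open>93312 < 10 ^ 7\<close>.\<close>
    have "2 * (2 * real m + 2) ^ 6 \<le> 2 * (6 * x) ^ 6"
      using m False by (intro mult_left_mono power_mono) auto
    also have "\<dots> = 93312 * x ^ 6" by (simp add: power_mult_distrib)
    also have "\<dots> \<le> 93312 * x ^ 7"
      using False by (intro mult_left_mono power_increasing) auto
    also have "\<dots> < real n" using n by (simp add: x7)
    finally have "real (2 * (2 * m + 2) ^ 6) < real n" by (simp add: add.commute)
    then have "2 * (2 * m + 2) ^ 6 < n" by (simp only: of_nat_less_iff)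
    then have "2 ^ 2 ^ m < ramsey_number 4 5 n" by (rule ramsey_number_step_up)
    then have "real (2 ^ 2 ^ m) \<le> real (ramsey_number 4 5 n)" by (simp only: of_nat_le_iff)
    moreover have "2 powr (2 powr x) \<le> (2::real) powr (2 powr real m)"
      using m by (intro powr_mono) auto
    moreover have "(2::real) powr (2 powr real m) = real (2 ^ 2 ^ m)"
      by (simp add: powr_realpow flip: powr_realpow[of 2 "2 ^ m"])
    ultimately show "2 powr (2 powr x) \<le> real (ramsey_number 4 5 n)" by linarith
  qed
qed simp

end
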